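(* Let $q_1,q_2,q_3\ge 0$ with $q_1+q_2+q_3=1$, and let $(\mathcal{G}_3',u)$ be the initializing extension of $(\mathcal{G}_3,u)$ with initial distribution $(q_1,q_2,q_3)$, considered under the Markov realization, where the payoff $u$ satisfies $$u_1(a_2)>u_1(a_1)>u_1(a_3)>u_1(c),\quad u_2(a_3)>u_2(a_2)>u_2(a_1)>u_2(c),\quad u_3(a_1)>u_3(a_3)>u_3(a_2)>u_3(c).$$ Set $$\mu_1=\frac{u_1(a_2)-u_1(a_1)}{u_1(a_1)-u_1(a_3)},\quad \mu_2=\frac{u_2(a_3)-u_2(a_2)}{u_2(a_2)-u_2(a_1)},\quad \mu_3=\frac{u_3(a_1)-u_3(a_3)}{u_3(a_3)-u_3(a_2)}.$$ If $\mu_1\mu_2\mu_3<1$, then $(\mathcal{G}_3',u)$ has a unique Nash equilibrium in strictly mixed strategies, and it is given by $$p_1=\frac{\mu_3(1+\mu_1+\mu_1\mu_2)}{1+\mu_3+\mu_3\mu_1},\quad p_2=\frac{\mu_1(1+\mu_2+\mu_2\mu_3)}{1+\mu_1+\mu_1\mu_2},\quad p_3=\frac{\mu_2(1+\mu_3+\mu_3\mu_1)}{1+\mu_2+\mu_2\mu_3}.$$ If $\mu_1\mu_2\mu_3\ge 1$, then $(\mathcal{G}_3',u)$ has no Nash equilibrium in strictly mixed strategies.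
   Context: Game structure $\mathcal{G}_3$: the directed graph has non-terminal positions $v_1,v_2,v_3$, terminal positions $a_1,a_2,a_3$, and arcs $(v_1,v_2),(v_2,v_3),(v_3,v_1)$ (the cycle) and $(v_i,a_i)$, $i=1,2,3$. Player $i\in\{1,2,3\}$ controls $v_i$. The outcomes are $a_1,a_2,a_3$ (termination there) and $c$ (infinite play). A payoff is $u:\{1,2,3\}\times\{a_1,a_2,a_3,c\}\to\mathbb{R}$, written $u_i(a)$. The initializing extension $\mathcal{G}_3'$ adds a position of chance $v_0$, which is the initial position, with moves $(v_0,v_j)$ taken with probability $q_j$, $j=1,2,3$. A mixed strategy of player $i$ is a number $p_i\in[0,1]$: the probability of following the cycle from $v_i$; with probability $1-p_i$ the player moves to $a_i$. Under the Markov realization the move is drawn afresh and independently each time a position is visited. Thus if $p_1=p_2=p_3=1$ the outcome is $c$ with probability 1; otherwise, with $\Delta=1-p_1p_2p_3$, the distribution on $(a_1,a_2,a_3,c)$ is $\frac1\Delta(1-p_1,\;p_1(1-p_2),\;p_1p_2(1-p_3),\;0)$ when play starts in $v_1$, $\frac1\Delta(p_2p_3(1-p_1),\;1-p_2,\;p_2(1-p_3),\;0)$ when it starts in $v_2$, $\frac1\Delta(p_3(1-p_1),\;p_1p_3(1-p_2),\;1-p_3,\;0)$ when it starts in $v_3$. In $\mathcal{G}_3'$ the expected payoff of player $i$ is $\sum_{j=1}^3 q_j$ times the expectation of $u_i$ when starting in $v_j$. A triple $(p_1,p_2,p_3)\in[0,1]^3$ is a Nash equilibrium of $(\mathcal{G}_3',u)$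 if no player can strictly increase his expected payoff by changing only his own $p_i$ to any other value in $[0,1]$. It is in strictly mixed strategies if $0<p_i<1$ for $i=1,2,3$. *)

theory Defs
  imports "HOL-Probability.Probability"
begin

datatype player = P1 | P2 | P3

lemma UNIV_player: "UNIV = {P1, P2, P3}"
  by (auto intro: player.exhaust)

instance player :: finite
  by standard (simp add: UNIV_player)

text \<open>\<open>Pos i\<close> is the position controlled by player \<open>i\<close>, \<open>Terminal i\<close> the terminal
  position attached to it, \<open>Exit i\<close> the outcome of terminating there, and \<open>Cycle\<close> the
  outcome of an infinite play.\<close>

datatype position = Pos player | Terminal player

datatype outcome = Exit player | Cycle

primrec next_player :: "player \<Rightarrow> player" where
  "next_player P1 = P2"
| "next_player P2 = P3"
| "next_player P3 = P1"

text \<open>A realisation of the random moves is a stream \<open>\<omega>\<close>, where \<open>(\<omega> !! n) i\<close> says whether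
  player \<open>i\<close> follows the cycle if the play is in \<^term>\<open>Pos i\<close> at time \<open>n\<close>.\<close>

primrec play :: "player \<Rightarrow> (player \<Rightarrow> bool) stream \<Rightarrow> nat \<Rightarrow> position" where
  "play j \<omega> 0 = Pos j"
| "play j \<omega> (Suc n) = (case play j \<omega> n of
      Pos i \<Rightarrow> if (\<omega> !! n) i then Pos (next_player i) else Terminal i
    | Terminal i \<Rightarrow> Terminal i)"

definition outcome :: "player \<Rightarrow> (player \<Rightarrow> bool) stream \<Rightarrow> outcome" where
  "outcome j \<omega> = (if \<exists>i n. play j \<omega> n = Terminal i
     then Exit (THE i. \<exists>n. play j \<omega> n = Terminal i) else Cycle)"

text \<open>Markov realisation: all draws \<open>(\<omega> !! n) i\<close> are independent, and each is true with probability
  \<open>p i\<close>. A play uses at most one draw at each time, so every visit to a position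
  gets a fresh draw.\<close>

definition markov :: "(player \<Rightarrow> real) \<Rightarrow> (player \<Rightarrow> bool) stream measure" where
  "markov p = stream_space (measure_pmf (Pi_pmf UNIV False (\<lambda>i. bernoulli_pmf (p i))))"

text \<open>The initial chance position moves to \<open>Pos j\<close> with probability \<open>q j\<close>; it is accounted for by
  the weighted sum over the starting positions.\<close>

definition expected_payoff ::
    "(player \<Rightarrow> real) \<Rightarrow> (player \<Rightarrow> outcome \<Rightarrow> real) \<Rightarrow> (player \<Rightarrow> real) \<Rightarrow> player \<Rightarrow> real" where
  "expected_payoff q u p i = (\<Sum>j\<in>UNIV. q j * (\<integral>\<omega>. u i (outcome j \<omega>) \<partial>markov p))"

definition nash_equilibrium ::
    "(player \<Rightarrow> real) \<Rightarrow> (player \<Rightarrow> outcome \<Rightarrow> real) \<Rightarrow> (player \<Rightarrow> real) \<Rightarrow> bool" where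
  "nash_equilibrium q u p \<longleftrightarrow>
     (\<forall>i. p i \<in> {0..1}) \<and>
     (\<forall>i. \<forall>x\<in>{0..1}. \<not> expected_payoff q u (p(i := x)) i > expected_payoff q u p i)"

definition strictly_mixed :: "(player \<Rightarrow> real) \<Rightarrow> bool" where
  "strictly_mixed p \<longleftrightarrow> (\<forall>i. 0 < p i \<and> p i < 1)"

text \<open>The outcome is a random variable, with the explicit distribution of \<open>prob_outcome\<close> if some
  player leaves the cycle with positive probability, and almost surely \<open>Cycle\<close> otherwise.\<close>

lemma play_SCons:
  "play j (x ## \<omega>) (Suc n) = (if x j then play (next_player j) \<omega> n else Terminal j)"
  by (induction n) (auto split: position.splits)

lemma play_Terminal_unique:
  assumes "play j \<omega> m = Terminal i" "play j \<omega> n = Terminal k"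
  shows "i = k"
proof -
  have stay: "play j \<omega> (a + d) = Terminal l" if "play j \<omega> a = Terminal l" for a d l
    using that by (induction d) auto
  show ?thesis
    using stay[OF assms(1), of n] stay[OF assms(2), of m] by (simp add: add.commute)
qed

lemma outcome_eq_Exit_iff: "outcome j \<omega> = Exit k \<longleftrightarrow> (\<exists>n. play j \<omega> n = Terminal k)"
proof -
  have the: "(THE i. \<exists>n. play j \<omega> n = Terminal i) = l" if "play j \<omega> n = Terminal l" for l n
    using that play_Terminal_unique by blast
  then show ?thesis
    unfolding outcome_def by (auto dest: the)
qed

lemma outcome_eq_Cycle_iff: "outcome j \<omega> = Cycle \<longleftrightarrow> (\<forall>n. \<exists>i. play j \<omega> n = Pos i)"
  unfolding outcome_def by (auto; metis position.exhaust position.distinct(1))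

lemma outcome_SCons:
  "outcome j (x ## \<omega>) = (if x j then outcome (next_player j) \<omega> else Exit j)"
proof -
  have ex: "(\<exists>n. play j (x ## \<omega>) n = Terminal k) \<longleftrightarrow> (\<exists>n. play j (x ## \<omega>) (Suc n) = Terminal k)" for k
    by (metis not0_implies_Suc play.simps(1) position.distinct(1))
  have "outcome j (x ## \<omega>) = Exit k \<longleftrightarrow>
      (if x j then outcome (next_player j) \<omega> else Exit j) = Exit k" for k
    unfolding outcome_eq_Exit_iff ex play_SCons by (auto simp: outcome_eq_Exit_iff)
  then show ?thesis
    by (metis outcome.exhaust)
qed

lemma space_markov [simp]: "space (markov p) = UNIV"
  by (simp add: markov_def space_stream_space)

lemma prob_space_markov: "prob_space (markov p)"
  unfolding markov_def by (rule prob_space.prob_space_stream_space) unfold_locales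

lemma measurable_snth_markov [measurable]:
  "(\<lambda>\<omega>. \<omega> !! n) \<in> measurable (markov p) (count_space UNIV)"
  unfolding markov_def by (rule measurable_compose[OF measurable_snth]) simp

lemma measurable_play [measurable]:
  "(\<lambda>\<omega>. play j \<omega> n) \<in> measurable (markov p) (count_space UNIV)"
proof (induction n)
  case (Suc n)
  have fin: "finite (UNIV :: position set)"
  proof (rule finite_subset)
    show "UNIV \<subseteq> range Pos \<union> range Terminal"
      by (auto intro: position.exhaust)
  qed simp
  have "(\<lambda>\<omega>. case s of
      Pos i \<Rightarrow> if (\<omega> !! n) i then Pos (next_player i) else Terminal i
    | Terminal i \<Rightarrow> Terminal i) \<in> measurable (markov p) (count_space UNIV)" for s
  proof (cases s)
    case (Pos i)
    show ?thesis
      unfolding Pos position.case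
      by (rule measurable_compose[OF measurable_snth_markov[of n]]) simp
  qed simp
  then show ?case
    unfolding play.simps
    by (rule measurable_compose_countable'[OF _ Suc]) (rule countable_finite[OF fin])
qed simp

lemma measurable_outcome [measurable]:
  "outcome j \<in> measurable (markov p) (count_space UNIV)"
proof -
  have "{\<omega> \<in> space (markov p). outcome j \<omega> = Exit k} \<in> sets (markov p)" for k
    unfolding outcome_eq_Exit_iff by measurable
  moreover have "{\<omega> \<in> space (markov p). outcome j \<omega> = Cycle} \<in> sets (markov p)"
    unfolding outcome_eq_Cycle_iff by measurable
  ultimately have *: "{\<omega> \<in> space (markov p). outcome j \<omega> = a} \<in> sets (markov p)" for a
    by (cases a) auto
  have "finite (UNIV :: outcome set)"
  proof (rule finite_subset)
    show "UNIV \<subseteq> insert Cycle (range Exit)"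
      by (auto intro: outcome.exhaust)
  qed simp
  then show ?thesis
    using * by (subst measurable_count_space_eq2) (auto simp: vimage_def Int_def conj_commute)
qed

lemma prob_outcome_step:
  assumes "\<And>i. p i \<in> {0..1}"
  shows "measure (markov p) {\<omega>. outcome j \<omega> = a} =
    (1 - p j) * of_bool (a = Exit j) + p j * measure (markov p) {\<omega>. outcome (next_player j) \<omega> = a}"
proof -
  define D where "D = Pi_pmf UNIV False (\<lambda>i. bernoulli_pmf (p i))"
  define m where "m = measure (markov p) {\<omega>. outcome (next_player j) \<omega> = a}"
  have M: "markov p = stream_space (measure_pmf D)"
    by (simp add: markov_def D_def)
  have [simp]: "space (stream_space (measure_pmf D)) = UNIV"
    by (simp add: space_stream_space)
  interpret P: prob_space "markov p"
    by (rule prob_space_markov)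
  have m: "0 \<le> m"
    by (simp add: m_def)
  have shift: "measure (markov p) {\<omega>. outcome j (x ## \<omega>) = a} = (if x j then m else of_bool (a = Exit j))" for x
    using P.prob_space by (cases "x j"; cases "a = Exit j") (auto simp: outcome_SCons m_def)
  have "{\<omega> \<in> space (markov p). outcome j \<omega> = a} \<in> sets (markov p)"
    by measurable
  then have "ennreal (measure (markov p) {\<omega>. outcome j \<omega> = a}) =
      (\<integral>\<^sup>+x. measure (markov p) {\<omega>. outcome j (x ## \<omega>) = a} \<partial>measure_pmf D)"
    using prob_space.prob_stream_space[OF measure_pmf.prob_space_axioms, of D "\<lambda>\<omega>. outcome j \<omega> = a"] unfolding M by (simp only: \<open>space (stream_space (measure_pmf D)) = UNIV\<close> UNIV_I simp_thms)
  also have "\<dots> = (\<integral>\<^sup>+x. (if x j then m else of_bool (a = Exit j)) \<partial>measure_pmf D)"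
    by (simp only: shift)
  also have "\<dots> = (\<integral>\<^sup>+b. (if b then m else of_bool (a = Exit j))
      \<partial>measure_pmf (map_pmf (\<lambda>x. x j) D))"
    by simp
  also have "map_pmf (\<lambda>x. x j) D = bernoulli_pmf (p j)"
    unfolding D_def by (subst Pi_pmf_component) auto
  also have "(\<integral>\<^sup>+b. (if b then m else of_bool (a = Exit j)) \<partial>measure_pmf (bernoulli_pmf (p j))) =
      ennreal ((1 - p j) * of_bool (a = Exit j) + p j * m)"
    using assms[of j] m
    by (subst nn_integral_measure_pmf_support[of UNIV])
      (simp_all add: UNIV_bool ennreal_mult' mult.commute)
  finally show ?thesis
    using assms[of j] m
    by (subst (asm) ennreal_inj) (simp_all add: m_def)
qed

lemma prob_outcome:
  assumes "\<And>i. p i \<in> {0..1}" and "p P1 * p P2 * p P3 \<noteq> 1"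
  defines "\<Delta> \<equiv> 1 - p P1 * p P2 * p P3"
  defines "pr j a \<equiv> measure (markov p) {\<omega>. outcome j \<omega> = a}"
  shows
    "pr P1 (Exit P1) = (1 - p P1) / \<Delta>"
    "pr P1 (Exit P2) = p P1 * (1 - p P2) / \<Delta>"
    "pr P1 (Exit P3) = p P1 * p P2 * (1 - p P3) / \<Delta>"
    "pr P2 (Exit P1) = p P2 * p P3 * (1 - p P1) / \<Delta>"
    "pr P2 (Exit P2) = (1 - p P2) / \<Delta>"
    "pr P2 (Exit P3) = p P2 * (1 - p P3) / \<Delta>"
    "pr P3 (Exit P1) = p P3 * (1 - p P1) / \<Delta>"
    "pr P3 (Exit P2) = p P1 * p P3 * (1 - p P2) / \<Delta>"
    "pr P3 (Exit P3) = (1 - p P3) / \<Delta>"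
    "pr j Cycle = 0"
proof -
  have nz: "\<Delta> \<noteq> 0"
    using assms(2) by (simp add: \<Delta>_def)
  have step: "pr j a = (1 - p j) * of_bool (a = Exit j) + p j * pr (next_player j) a" for j a
    unfolding pr_def by (rule prob_outcome_step) (rule assms(1))
  have eqs: "pr P1 a = (1 - p P1) * of_bool (a = Exit P1) + p P1 * pr P2 a"
    "pr P2 a = (1 - p P2) * of_bool (a = Exit P2) + p P2 * pr P3 a"
    "pr P3 a = (1 - p P3) * of_bool (a = Exit P3) + p P3 * pr P1 a" for a
    using step[of P1 a] step[of P2 a] step[of P3 a] by simp_all
  have sol: "\<Delta> * pr P1 a = (1 - p P1) * of_bool (a = Exit P1)
      + p P1 * (1 - p P2) * of_bool (a = Exit P2) + p P1 * p P2 * (1 - p P3) * of_bool (a = Exit P3)"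
    "\<Delta> * pr P2 a = (1 - p P2) * of_bool (a = Exit P2)
      + p P2 * (1 - p P3) * of_bool (a = Exit P3) + p P2 * p P3 * (1 - p P1) * of_bool (a = Exit P1)"
    "\<Delta> * pr P3 a = (1 - p P3) * of_bool (a = Exit P3)
      + p P3 * (1 - p P1) * of_bool (a = Exit P1) + p P1 * p P3 * (1 - p P2) * of_bool (a = Exit P2)"
    for a
    using eqs[of a] unfolding \<Delta>_def by algebra+
  show "pr P1 (Exit P1) = (1 - p P1) / \<Delta>"
    "pr P1 (Exit P2) = p P1 * (1 - p P2) / \<Delta>"
    "pr P1 (Exit P3) = p P1 * p P2 * (1 - p P3) / \<Delta>"
    "pr P2 (Exit P1) = p P2 * p P3 * (1 - p P1) / \<Delta>"
    "pr P2 (Exit P2) = (1 - p P2) / \<Delta>"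
    "pr P2 (Exit P3) = p P2 * (1 - p P3) / \<Delta>"
    "pr P3 (Exit P1) = p P3 * (1 - p P1) / \<Delta>"
    "pr P3 (Exit P2) = p P1 * p P3 * (1 - p P2) / \<Delta>"
    "pr P3 (Exit P3) = (1 - p P3) / \<Delta>"
    using nz sol[of "Exit P1"] sol[of "Exit P2"] sol[of "Exit P3"]
    by (simp_all add: eq_divide_eq mult.commute)
  show "pr j Cycle = 0"
    using nz sol[of Cycle] by (cases j) auto
qed

lemma AE_outcome_Cycle:
  assumes "\<And>i. p i = 1"
  shows "AE \<omega> in markov p. outcome j \<omega> = Cycle"
proof -
  define D where "D = Pi_pmf UNIV False (\<lambda>i. bernoulli_pmf (p i))"
  have "x i" if "x \<in> set_pmf D" for x i
  proof -
    have "x i \<in> set_pmf (map_pmf (\<lambda>x. x i) D)"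
      using that by simp
    also have "map_pmf (\<lambda>x. x i) D = bernoulli_pmf 1"
      unfolding D_def by (subst Pi_pmf_component) (auto simp: assms)
    finally show ?thesis
      by (cases "x i") (simp_all add: set_pmf_eq)
  qed
  then have "AE x in measure_pmf D. \<forall>i. x i"
    unfolding AE_measure_pmf_iff by blast
  then have "AE \<omega> in markov p. stream_all (\<lambda>x. \<forall>i. x i) \<omega>"
    unfolding markov_def D_def[symmetric] by (intro prob_space.AE_stream_all[OF measure_pmf.prob_space_axioms]) auto
  then show ?thesis
  proof eventually_elim
    case (elim \<omega>)
    have "\<exists>i. play j \<omega> n = Pos i" for n
    proof (induction n)
      case (Suc n)
      moreover have "(\<omega> !! n) i" for i
        using elim snth_sset[of \<omega> n] by blast
      ultimately show ?case
        by auto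
    qed simp
    then show ?case
      by (simp add: outcome_eq_Cycle_iff)
  qed
qed

end

theory Submission
  imports Defs
begin

text \<open>Fix the strategies of the other two players and let player \<open>i\<close> follow the cycle with
  probability \<open>x\<close>. Unrolling one round of the cycle gives an affine equation for his value when
  starting at his own position, whose solution is \<open>u i (Exit i) + x * G / (1 - x * r)\<close>, where \<open>r\<close>
  is the product of the other two probabilities and \<open>G\<close> does not depend on \<open>x\<close>. His payoff in the
  extended game is an increasing affine function of this value, so that
  an interior \<open>x\<close> is a best reply iff \<open>G = 0\<close>. The distribution \<open>q\<close> thus plays no role, and the
  equilibria are the interior solutions of
  \[ \mu_1 (1 - p_2) = p_2 (1 - p_3), \quad \mu_2 (1 - p_3) = p_3 (1 - p_1), \quad
     \mu_3 (1 - p_1) = p_1 (1 - p_2). \]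
  Multiplying these gives $\mu_1 \mu_2 \mu_3 = p_1 p_2 p_3 < 1$; with the value of this product
  known, the system becomes linear.\<close>

lemma UNIV_outcome: "UNIV = {Exit P1, Exit P2, Exit P3, Cycle}"
proof -
  have "a \<in> {Exit P1, Exit P2, Exit P3, Cycle}" for a
  proof (cases a)
    case (Exit k)
    then show ?thesis by (cases k) auto
  qed simp
  then show ?thesis by blast
qed

instance outcome :: finite
  by standard (simp add: UNIV_outcome)

definition start_payoff :: "(outcome \<Rightarrow> real) \<Rightarrow> (player \<Rightarrow> real) \<Rightarrow> player \<Rightarrow> real" where
  "start_payoff f p j = (\<integral>\<omega>. f (outcome j \<omega>) \<partial>markov p)"

text \<open>With finitely many outcomes, the payoff is a finite combination of indicators, so the
  recursion for outcome probabilities carries over to expectations.\<close>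

lemma start_payoff_eq_sum:
  "start_payoff f p j = (\<Sum>a\<in>UNIV. f a * measure (markov p) {\<omega>. outcome j \<omega> = a})"
proof -
  interpret prob_space "markov p"
    by (rule prob_space_markov)
  have sets: "{\<omega>. outcome j \<omega> = a} \<in> sets (markov p)" for a
    using measurable_sets[OF measurable_outcome, of "{a}" j p] by (simp add: vimage_def)
  have "f (outcome j \<omega>) = (\<Sum>a\<in>UNIV. f a * indicator {\<omega>. outcome j \<omega> = a} \<omega>)" for \<omega>
    by (simp add: indicator_def of_bool_def if_distrib[of "\<lambda>x. _ * x"] sum.delta cong: if_cong)
  then have "start_payoff f p j =
      (\<integral>\<omega>. (\<Sum>a\<in>UNIV. f a * indicator {\<omega>. outcome j \<omega> = a} \<omega>) \<partial>markov p)"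
    by (simp add: start_payoff_def)
  also have "\<dots> = (\<Sum>a\<in>UNIV. \<integral>\<omega>. f a * indicator {\<omega>. outcome j \<omega> = a} \<omega> \<partial>markov p)"
    using sets by (intro Bochner_Integration.integral_sum) (simp add: emeasure_eq_measure)
  finally show ?thesis
    using sets by simp
qed

lemma start_payoff_step:
  assumes "\<And>i. p i \<in> {0..1}"
  shows "start_payoff f p j = (1 - p j) * f (Exit j) + p j * start_payoff f p (next_player j)"
proof -
  have "(\<Sum>a\<in>UNIV. f a * of_bool (a = Exit j)) = f (Exit j)"
    by (simp add: of_bool_def if_distrib[of "\<lambda>x. _ * x"] sum.delta cong: if_cong)
  moreover have "start_payoff f p j = (1 - p j) * (\<Sum>a\<in>UNIV. f a * of_bool (a = Exit j))
      + p j * start_payoff f p (next_player j)"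
    unfolding start_payoff_eq_sum prob_outcome_step[of p, OF assms, of j] sum_distrib_left
    by (simp add: mult.left_commute distrib_left sum.distrib)
  ultimately show ?thesis by simp
qed

text \<open>Expected excess over \<open>u i (Exit i)\<close> in one round after \<open>i\<close>
  follows the cycle, a return to \<open>Pos i\<close> counting as zero excess.\<close>

definition follow_gain :: "(player \<Rightarrow> outcome \<Rightarrow> real) \<Rightarrow> (player \<Rightarrow> real) \<Rightarrow> player \<Rightarrow> real" where
  "follow_gain u p i = (let k = next_player i; l = next_player k in
     (1 - p k) * (u i (Exit k) - u i (Exit i)) + p k * (1 - p l) * (u i (Exit l) - u i (Exit i)))"

lemma next_player_cycle:
  "next_player (next_player (next_player i)) = i"
  "next_player i \<noteq> i" "next_player (next_player i) \<noteq> i"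
  "next_player (next_player i) \<noteq> next_player i"
  by (cases i; simp)+

lemma expected_payoff_update:
  fixes q p :: "player \<Rightarrow> real" and u :: "player \<Rightarrow> outcome \<Rightarrow> real"
  assumes q: "\<And>j. q j \<ge> 0" "q P1 + q P2 + q P3 = 1" and p: "strictly_mixed p"
  obtains C w r where "0 < w" "0 \<le> r" "r < 1"
    "\<And>x. x \<in> {0..1} \<Longrightarrow>
      expected_payoff q u (p(i := x)) i = C + w * (x * follow_gain u p i / (1 - x * r))"
proof -
  define k l where "k = next_player i" and "l = next_player k"
  have cyc: "k \<noteq> i" "l \<noteq> i" "l \<noteq> k" "next_player l = i"
    by (simp_all add: k_def l_def next_player_cycle)
  have UNIV_eq: "UNIV = {i, k, l}"
    by (cases i) (auto simp: k_def l_def UNIV_player)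
  have pk: "0 < p k" "p k < 1" and pl: "0 < p l" "p l < 1"
    using p by (auto simp: strictly_mixed_def)
  \<comment> \<open>\<open>w\<close> is the probability that the play ever visits
    \<open>Pos i\<close>, and \<open>C\<close> below is the expected payoff if the first such visit
    were worth exactly \<open>u i (Exit i)\<close>.\<close>
  define r w where "r = p k * p l" and "w = q i + q k * r + q l * p l"
  define C where "C = q i * u i (Exit i)
    + q k * ((1 - p k) * u i (Exit k) + p k * (1 - p l) * u i (Exit l) + r * u i (Exit i))
    + q l * ((1 - p l) * u i (Exit l) + p l * u i (Exit i))"
  have r: "0 < r" "r < 1"
    using pk pl mult_strict_mono[of "p k" 1 "p l" 1] by (simp_all add: r_def)
  have "q i + q k + q l = 1"
    using q(2) by (cases i) (simp_all add: k_def l_def)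
  \<comment> \<open>Some starting position has positive weight, and \<open>Pos i\<close> is reached
    from each with positive probability.\<close>
  then have "q i > 0 \<or> q k > 0 \<or> q l > 0"
    using q(1)[of i] q(1)[of k] q(1)[of l] by linarith
  moreover have "0 \<le> q i" "0 \<le> q k * r" "0 \<le> q l * p l"
    using q(1) r pl by simp_all
  ultimately have "0 < w"
    unfolding w_def using r pl by (smt (verit) mult_pos_pos)
  moreover have "expected_payoff q u (p(i := x)) i = C + w * (x * follow_gain u p i / (1 - x * r))"
    if x: "x \<in> {0..1}" for x
  proof -
    define V where "V = start_payoff (u i) (p(i := x))"
    have "(p(i := x)) j \<in> {0..1}" for j
      using p x by (auto simp: strictly_mixed_def less_imp_le)
    note step = start_payoff_step[of "p(i := x)", OF this, of "u i", folded V_def]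
    have Vi: "V i = (1 - x) * u i (Exit i) + x * V k"
      using step[of i] by (simp add: k_def)
    have Vk: "V k = (1 - p k) * u i (Exit k) + p k * V l"
      using step[of k] cyc by (simp add: l_def)
    have Vl: "V l = (1 - p l) * u i (Exit l) + p l * V i"
      using step[of l] cyc by simp
    have "x * r < 1"
      using x r by (intro le_less_trans[OF mult_left_le_one_le]) auto
    \<comment> \<open>Writing E for the excess \<open>V i - u i (Exit i)\<close>, one round around
      the cycle gives E = x * (G + r * E) with G = \<open>follow_gain u p i\<close>.\<close>
    moreover have "(V i - u i (Exit i)) * (1 - x * r) = x * follow_gain u p i"
      unfolding follow_gain_def Let_def k_def[symmetric] l_def[symmetric] r_def
      using Vi Vk Vl by algebra
    ultimately have "V i - u i (Exit i) = x * follow_gain u p i / (1 - x * r)"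
      by (simp add: eq_divide_eq)
    moreover have "expected_payoff q u (p(i := x)) i = q i * V i + q k * V k + q l * V l"
      unfolding expected_payoff_def start_payoff_def[symmetric] V_def[symmetric] UNIV_eq
      using cyc by (simp add: add.assoc)
    moreover have "q i * V i + q k * V k + q l * V l = C + w * (V i - u i (Exit i))"
      unfolding C_def w_def r_def Vk Vl by (simp add: algebra_simps)
    ultimately show ?thesis by simp
  qed
  ultimately show thesis
    using that[of w r C] r by simp
qed

text \<open>Since x / (1 - x * r) is strictly increasing on [0,1], the payoff is strictly monotone
  in x unless the gain vanishes. Comparison with the pure deviations 0 and 1 therefore
  suffices.\<close>

lemma best_reply_iff:
  assumes q: "\<And>j. q j \<ge> 0" "q P1 + q P2 + q P3 = 1" and p: "strictly_mixed p"
  shows "(\<forall>x\<in>{0..1}. \<not> expected_payoff q u (p(i := x)) i > expected_payoff q u p i)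
    \<longleftrightarrow> follow_gain u p i = 0"
proof -
  define G where "G = follow_gain u p i"
  obtain C w r where w: "0 < w" and r: "0 \<le> r" "r < 1" and
    payoff: "\<And>x. x \<in> {0..1} \<Longrightarrow>
      expected_payoff q u (p(i := x)) i = C + w * (x * G / (1 - x * r))"
    unfolding G_def using expected_payoff_update[OF q p] by metis
  have pi: "0 < p i" "p i < 1"
    using p by (auto simp: strictly_mixed_def)
  have rp: "p i * r < 1"
    using pi r by (intro le_less_trans[OF mult_left_le_one_le]) auto
  have current: "expected_payoff q u p i = C + w * (p i * G / (1 - p i * r))"
    using payoff[of "p i"] pi by simp
  show ?thesis
  proof
    assume best: "\<forall>x\<in>{0..1}. \<not> expected_payoff q u (p(i := x)) i > expected_payoff q u p i"
    have "0 \<le> w * (p i * G / (1 - p i * r))"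
      using best[THEN bspec, of 0] payoff[of 0] current by (simp add: not_less)
    then have "0 \<le> G"
      using w pi rp by (simp add: zero_le_divide_iff zero_le_mult_iff)
    have "w * (G / (1 - r)) \<le> w * (p i * G / (1 - p i * r))"
      using best[THEN bspec, of 1] payoff[of 1] current by (simp add: not_less)
    then have "G / (1 - r) \<le> p i * G / (1 - p i * r)"
      using w by (simp only: mult_le_cancel_left_pos)
    \<comment> \<open>Cross-multiplication makes the terms in \<open>r\<close> cancel.\<close>
    then have "G * (1 - p i) \<le> 0"
      using r rp by (simp add: field_simps)
    then have "G \<le> 0"
      using pi by (simp add: mult_le_0_iff)
    with \<open>0 \<le> G\<close> show "follow_gain u p i = 0"
      by (simp add: G_def)
  next
    assume "follow_gain u p i = 0"
    then show "\<forall>x\<in>{0..1}. \<not> expected_payoff q u (p(i := x)) i > expected_payoff q u p i"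
      using payoff current by (simp add: G_def)
  qed
qed

lemma nash_strictly_mixed_iff:
  assumes "\<And>j. q j \<ge> 0" "q P1 + q P2 + q P3 = 1"
  shows "nash_equilibrium q u p \<and> strictly_mixed p \<longleftrightarrow>
    strictly_mixed p \<and> (\<forall>i. follow_gain u p i = 0)"
  using best_reply_iff[OF assms, of p u]
  unfolding nash_equilibrium_def by (auto simp: strictly_mixed_def less_imp_le)

text \<open>The system is invariant under rotating (x,y,z) and (a,b,c) together, so a formula for
  \<open>x\<close> also yields those for \<open>y\<close> and \<open>z\<close>.\<close>

lemma cyclic_system_imp_eq:
  fixes x y z a b c :: real
  assumes pos: "0 < a" "0 < b" "0 < c" "0 < x" "x < 1" "0 < y" "y < 1" "0 < z" "z < 1"
    and eqs: "a * (1 - y) = y * (1 - z)" "b * (1 - z) = z * (1 - x)" "c * (1 - x) = x * (1 - y)"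
  shows "a * b * c = x * y * z" and "x = c * (1 + a + a * b) / (1 + c + c * a)"
proof -
  have "a * b * c * ((1 - x) * (1 - y) * (1 - z)) =
      (a * (1 - y)) * (b * (1 - z)) * (c * (1 - x))"
    by (simp add: mult_ac)
  also have "\<dots> = x * y * z * ((1 - x) * (1 - y) * (1 - z))"
    unfolding eqs by (simp add: mult_ac)
  finally show abc: "a * b * c = x * y * z"
    using pos by simp
  \<comment> \<open>The first equation times \<open>x\<close>, with the third and
    \<open>abc\<close>, gives x*y = c*a*(1 - x) + a*b*c. The third alone gives x*y = x*(1 + c) -
    c.\<close>
  have "x * (1 + c + c * a) = c * (1 + a + a * b)"
    using eqs abc by algebra
  moreover have "1 + c + c * a > 0"
    using pos by (simp add: add_pos_pos)
  ultimately show "x = c * (1 + a + a * b) / (1 + c + c * a)"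
    by (simp add: eq_divide_eq)
qed

text \<open>Denominator minus numerator is exactly 1 - a*b*c.\<close>

lemma cyclic_ratio_bounds:
  fixes a b c :: real
  assumes "0 < a" "0 < b" "0 < c" "a * b * c < 1"
  shows "0 < c * (1 + a + a * b) / (1 + c + c * a)" "c * (1 + a + a * b) / (1 + c + c * a) < 1"
  using assms by (simp_all add: add_pos_pos algebra_simps)

text \<open>The numerator of \<open>y\<close> is \<open>a\<close> times the denominator of
  \<open>z\<close>, and 1 - y and 1 - z share the numerator 1 - a*b*c, so the factors cancel.
  Rotation gives the other two equations.\<close>

lemma cyclic_ratio_solves:
  fixes a b c :: real
  assumes "0 < a" "0 < b" "0 < c"
  defines "y \<equiv> a * (1 + b + b * c) / (1 + a + a * b)"
    and "z \<equiv> b * (1 + c + c * a) / (1 + b + b * c)"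
  shows "a * (1 - y) = y * (1 - z)"
proof -
  have pos: "1 + a + a * b > 0" "1 + b + b * c > 0"
    using assms by (simp_all add: add_pos_pos)
  have y: "1 - y = (1 - a * b * c) / (1 + a + a * b)"
    using pos unfolding y_def by (simp add: field_simps)
  have z: "1 - z = (1 - a * b * c) / (1 + b + b * c)"
    using pos unfolding z_def by (simp add: field_simps)
  show ?thesis
    unfolding y z using pos unfolding y_def by simp
qed

text \<open>\<open>m\<close> compares what \<open>i\<close> gains from an exit at \<open>k\<close>
  with what an exit at \<open>l\<close> costs. Dividing the gain by this positive cost leaves an
  equation in \<open>m\<close>.\<close>

lemma follow_gain_eq_0_iff:
  assumes "k = next_player i" "l = next_player k" "u i (Exit i) > u i (Exit l)"
    and "m = (u i (Exit k) - u i (Exit i)) / (u i (Exit i) - u i (Exit l))"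
  shows "follow_gain u p i = 0 \<longleftrightarrow> m * (1 - p k) = p k * (1 - p l)"
proof -
  have "m * (u i (Exit i) - u i (Exit l)) = u i (Exit k) - u i (Exit i)"
    using assms(3,4) by simp
  then have "follow_gain u p i =
      (u i (Exit i) - u i (Exit l)) * (m * (1 - p k) - p k * (1 - p l))"
    unfolding follow_gain_def Let_def assms(1,2)[symmetric] by algebra
  then show ?thesis
    using assms(3) by simp
qed

theorem proposition6:
  fixes q :: "player \<Rightarrow> real"
    and u :: "player \<Rightarrow> outcome \<Rightarrow> real"
    and \<mu>1 \<mu>2 \<mu>3 :: real
  assumes "\<And>j. q j \<ge> 0" and "q P1 + q P2 + q P3 = 1"
    and "u P1 (Exit P2) > u P1 (Exit P1)"
    and "u P1 (Exit P1) > u P1 (Exit P3)"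
    and "u P1 (Exit P3) > u P1 Cycle"
    and "u P2 (Exit P3) > u P2 (Exit P2)"
    and "u P2 (Exit P2) > u P2 (Exit P1)"
    and "u P2 (Exit P1) > u P2 Cycle"
    and "u P3 (Exit P1) > u P3 (Exit P3)"
    and "u P3 (Exit P3) > u P3 (Exit P2)"
    and "u P3 (Exit P2) > u P3 Cycle"
    and "\<mu>1 = (u P1 (Exit P2) - u P1 (Exit P1)) / (u P1 (Exit P1) - u P1 (Exit P3))"
    and "\<mu>2 = (u P2 (Exit P3) - u P2 (Exit P2)) / (u P2 (Exit P2) - u P2 (Exit P1))"
    and "\<mu>3 = (u P3 (Exit P1) - u P3 (Exit P3)) / (u P3 (Exit P3) - u P3 (Exit P2))"
  shows "(\<mu>1 * \<mu>2 * \<mu>3 < 1 \<longrightarrow>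
      (\<exists>!p. nash_equilibrium q u p \<and> strictly_mixed p) \<and>
      (\<forall>p. nash_equilibrium q u p \<and> strictly_mixed p \<longrightarrow>
        p P1 = \<mu>3 * (1 + \<mu>1 + \<mu>1 * \<mu>2) / (1 + \<mu>3 + \<mu>3 * \<mu>1) \<and>
        p P2 = \<mu>1 * (1 + \<mu>2 + \<mu>2 * \<mu>3) / (1 + \<mu>1 + \<mu>1 * \<mu>2) \<and>
        p P3 = \<mu>2 * (1 + \<mu>3 + \<mu>3 * \<mu>1) / (1 + \<mu>2 + \<mu>2 * \<mu>3))) \<and>
    (\<mu>1 * \<mu>2 * \<mu>3 \<ge> 1 \<longrightarrow>
      \<not> (\<exists>p. nash_equilibrium q u p \<and> strictly_mixed p))"
proof -
  note \<mu> = assms(12-14)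
  have pos: "0 < \<mu>1" "0 < \<mu>2" "0 < \<mu>3"
    using assms(3-11) unfolding \<mu> by simp_all
  let ?p1 = "\<mu>3 * (1 + \<mu>1 + \<mu>1 * \<mu>2) / (1 + \<mu>3 + \<mu>3 * \<mu>1)"
  let ?p2 = "\<mu>1 * (1 + \<mu>2 + \<mu>2 * \<mu>3) / (1 + \<mu>1 + \<mu>1 * \<mu>2)"
  let ?p3 = "\<mu>2 * (1 + \<mu>3 + \<mu>3 * \<mu>1) / (1 + \<mu>2 + \<mu>2 * \<mu>3)"
  have all_player: "(\<forall>i. P i) \<longleftrightarrow> P P1 \<and> P P2 \<and> P P3" for P :: "player \<Rightarrow> bool"
    by (metis player.exhaust)
  have gain: "(\<forall>i. follow_gain u p i = 0) \<longleftrightarrow>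
      \<mu>1 * (1 - p P2) = p P2 * (1 - p P3) \<and>
      \<mu>2 * (1 - p P3) = p P3 * (1 - p P1) \<and>
      \<mu>3 * (1 - p P1) = p P1 * (1 - p P2)" for p
    unfolding all_player
    using follow_gain_eq_0_iff[of P2 P1 P3 u \<mu>1] follow_gain_eq_0_iff[of P3 P2 P1 u \<mu>2]
      follow_gain_eq_0_iff[of P1 P3 P2 u \<mu>3] assms(3-11) \<mu> by simp
  note equilibrium = nash_strictly_mixed_iff[of q, OF assms(1,2), of u, unfolded gain]
  \<comment> \<open>The inequality excludes equilibria when the product is at least 1; the three
    formulas give uniqueness.\<close>
  have necessary: "\<mu>1 * \<mu>2 * \<mu>3 < 1 \<and> p P1 = ?p1 \<and> p P2 = ?p2 \<and> p P3 = ?p3"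
    if "nash_equilibrium q u p \<and> strictly_mixed p" for p
  proof -
    have eqs: "\<mu>1 * (1 - p P2) = p P2 * (1 - p P3)" "\<mu>2 * (1 - p P3) = p P3 * (1 - p P1)"
        "\<mu>3 * (1 - p P1) = p P1 * (1 - p P2)"
      and p: "0 < p j" "p j < 1" for j
      using that unfolding equilibrium by (auto simp: strictly_mixed_def)
    have "p P1 * p P2 < 1"
      using p mult_strict_mono[of "p P1" 1 "p P2" 1] by (simp add: less_imp_le)
    then have "p P1 * p P2 * p P3 < 1"
      using p mult_strict_mono[of "p P1 * p P2" 1 "p P3" 1] by (simp add: less_imp_le)
    then show ?thesis
      using cyclic_system_imp_eq[OF pos p p p eqs]
        cyclic_system_imp_eq(2)[OF pos(2,3,1) p p p eqs(2,3,1)]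
        cyclic_system_imp_eq(2)[OF pos(3,1,2) p p p eqs(3,1,2)] by simp
  qed
  have existence: "\<exists>p. nash_equilibrium q u p \<and> strictly_mixed p" if less: "\<mu>1 * \<mu>2 * \<mu>3 < 1"
  proof -
    define p where "p = case_player ?p1 ?p2 ?p3"
    have p: "p P1 = ?p1" "p P2 = ?p2" "p P3 = ?p3"
      by (simp_all add: p_def)
    have perm: "\<mu>2 * \<mu>3 * \<mu>1 < 1" "\<mu>3 * \<mu>1 * \<mu>2 < 1"
      using less by (simp_all add: mult_ac)
    have "strictly_mixed p"
      unfolding strictly_mixed_def all_player p
      using cyclic_ratio_bounds[OF pos less] cyclic_ratio_bounds[OF pos(2,3,1) perm(1)]
        cyclic_ratio_bounds[OF pos(3,1,2) perm(2)] by blast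
    then show ?thesis
      using cyclic_ratio_solves[OF pos] cyclic_ratio_solves[OF pos(2,3,1)]
        cyclic_ratio_solves[OF pos(3,1,2)] equilibrium[of p] unfolding p by blast
  qed
  have unique: "p = p'"
    if "nash_equilibrium q u p \<and> strictly_mixed p" "nash_equilibrium q u p' \<and> strictly_mixed p'"
    for p p'
    using necessary[OF that(1)] necessary[OF that(2)] unfolding fun_eq_iff all_player by simp
  show ?thesis
    using necessary existence unique by (meson not_less)
qed

end
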